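(* Let $N\ge 1$ and let $\overline{A}\in\{0,1\}^{N\times N}$ be such that $\overline{A}_{nn}=1$ for all $n=1,\dots,N$ and such that the digraph on $V=\{1,\dots,N\}$ associated with $\overline{A}$ contains a Hamiltonian cycle. Then, for almost all $T\in\mathbb{C}^{N\times N}$, there exist matrices $A_1,\dots,A_N\in\operatorname{spr}(\overline{A})$ such that $$T=A_N A_{N-1}\cdots A_1 .$$ Here "for almost all $T$" means: the set of those $T\in\mathbb{C}^{N\times N}$ for which no such factorization exists has a closure that is nowhere dense in $\mathbb{C}^{N\times N}$.
   Context: For $\overline{A}\in\{0,1\}^{N\times N}$, the associated digraph on the vertex set $V=\{1,\dots,N\}$ has edge set $\{(n,l)\in V^2: \overline{A}_{nl}=1\}$ (self-loops allowed). A Hamiltonian cycle is a directed cycle that visits every vertex of $V$ exactly once. For $P\in\mathbb{C}^{N\times N}$ (in particular for $P\in\{0,1\}^{N\times N}$), the sparsity class induced by $P$ is the linear subspace $$\operatorname{spr}(P)=\{P'\in\mathbb{C}^{N\times N}: P_{nl}=0 \text{ implies } P'_{nl}=0\}.$$ Convention: "almost all" matrices in $\mathbb{C}^{N\times N}$ means all matrices except those in a set whose closure is nowhere dense in $\mathbb{C}^{N\times N}$ (with its usual Euclidean topology). *)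

theory Defs
  imports "HOL-Analysis.Analysis" "Graph_Theory.Pair_Digraph"
begin

definition matrix_digraph :: "complex^'n^'n \<Rightarrow> 'n pair_pre_digraph" where
  "matrix_digraph A = \<lparr> pverts = UNIV, parcs = {(n, l). A $ n $ l = 1} \<rparr>"

text \<open>
  Vertices visited by a cycle are counted as tails of its arcs, so that the vertex at which the
  closed walk starts and ends counts once. A loop is a cycle of length one; hence on a single vertex
  the Hamiltonian cycle is the loop.
\<close>

definition (in pre_digraph) hamiltonian_cycle :: "'b awalk \<Rightarrow> bool" where
  "hamiltonian_cycle p \<longleftrightarrow>
     cycle p \<and> (\<forall>v \<in> verts G. count_list (map (tail G) p) v = 1)"

definition spr :: "complex^'n^'n \<Rightarrow> (complex^'n^'n) set" where
  "spr P = {P'. \<forall>n l. P $ n $ l = 0 \<longrightarrow> P' $ n $ l = 0}"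

definition nowhere_dense :: "'a::topological_space set \<Rightarrow> bool" where
  "nowhere_dense S \<longleftrightarrow> interior (closure S) = {}"

definition almost_all :: "('a::topological_space \<Rightarrow> bool) \<Rightarrow> bool" where
  "almost_all Q \<longleftrightarrow> nowhere_dense (closure {x. \<not> Q x})"

text \<open>The product \<open>A k ** A (k - 1) ** \<dots> ** A 1\<close>.\<close>

primrec descending_prod :: "(nat \<Rightarrow> complex^'n^'n) \<Rightarrow> nat \<Rightarrow> complex^'n^'n" where
  "descending_prod A 0 = mat 1"
| "descending_prod A (Suc k) = A (Suc k) ** descending_prod A k"

end

theory Submission
  imports Defs "HOL-Computational_Algebra.Fundamental_Theorem_Algebra" "HOL-Number_Theory.Cong"
begin

text \<open>
  Let \<open>S\<close> be the cyclic shift along the Hamiltonian cycle. Every \<open>T\<close> is a polynomial of degree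
  \<open>N - 1\<close> in \<open>S\<close> with diagonal coefficients, and \<open>S - r\<close> is a right factor of such a polynomial
  \<open>P(S)\<close> as soon as \<open>r\<^sub>n = \<kappa> v\<^sub>n\<^sub>+\<^sub>1 / v\<^sub>n\<close> with \<open>P(\<kappa> S) v = 0\<close>. So one takes a root \<open>\<kappa>\<close> of
  \<open>det P(\<kappa> S)\<close> and for \<open>v\<close> a row of cofactors; splitting off \<open>N - 1\<close> linear factors leaves a diagonal
  matrix, the \<open>N\<close>-th factor. That this works outside the zero set of a nonzero polynomial follows by
  eliminating \<open>\<kappa>\<close>: if \<open>p\<close> and \<open>h\<close> are polynomials in \<open>(x, \<kappa>)\<close> and \<open>h\<close> does not vanish at all roots
  \<open>\<kappa>\<close> of \<open>p\<close> for one \<open>x\<close>, then the same holds for generic \<open>x\<close>.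
\<close>

section \<open>Polynomial functions\<close>

text \<open>Coordinates are indexed by an arbitrary type, so that one notion serves for the
  coefficients \<open>(j, a)\<close>, for these together with \<kappa>, and for matrix
  entries.\<close>

inductive polyfun :: "(('i \<Rightarrow> complex) \<Rightarrow> complex) \<Rightarrow> bool" where
  const: "polyfun (\<lambda>_. c)"
| coord: "polyfun (\<lambda>x. x i)"
| add: "polyfun f \<Longrightarrow> polyfun g \<Longrightarrow> polyfun (\<lambda>x. f x + g x)"
| mult: "polyfun f \<Longrightarrow> polyfun g \<Longrightarrow> polyfun (\<lambda>x. f x * g x)"

lemma polyfun_minus: "polyfun f \<Longrightarrow> polyfun (\<lambda>x. - f x)"
  using polyfun.mult[OF polyfun.const[of "-1"]] by simp

lemma polyfun_diff: "polyfun f \<Longrightarrow> polyfun g \<Longrightarrow> polyfun (\<lambda>x. f x - g x)"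
  using polyfun.add[OF _ polyfun_minus] by fastforce

lemma polyfun_power: "polyfun f \<Longrightarrow> polyfun (\<lambda>x. f x ^ k)"
  by (induction k) (auto intro: polyfun.intros)

lemma polyfun_sum: "(\<And>a. a \<in> A \<Longrightarrow> polyfun (f a)) \<Longrightarrow> polyfun (\<lambda>x. \<Sum>a\<in>A. f a x)"
  by (induction A rule: infinite_finite_induct) (auto intro: polyfun.intros)

lemma polyfun_prod: "(\<And>a. a \<in> A \<Longrightarrow> polyfun (f a)) \<Longrightarrow> polyfun (\<lambda>x. \<Prod>a\<in>A. f a x)"
  by (induction A rule: infinite_finite_induct) (auto intro: polyfun.intros)

lemma polyfun_if: "polyfun f \<Longrightarrow> polyfun g \<Longrightarrow> polyfun (\<lambda>x. if b then f x else g x)"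
  by (cases b) auto

lemma polyfun_det:
  fixes M :: "('i \<Rightarrow> complex) \<Rightarrow> complex^'n::finite^'n"
  assumes "\<And>a b. polyfun (\<lambda>x. M x $ a $ b)"
  shows "polyfun (\<lambda>x. det (M x))"
  unfolding det_def by (intro polyfun_sum polyfun.mult polyfun_prod polyfun.const assms)

lemmas polyfun_intros =
  polyfun.intros polyfun_minus polyfun_diff polyfun_power polyfun_sum polyfun_prod polyfun_if
  polyfun_det

lemma polyfun_compose:
  assumes "polyfun g" "\<And>i. polyfun (h i)"
  shows "polyfun (\<lambda>x. g (\<lambda>i. h i x))"
  using assms(1) by induction (auto intro: polyfun.intros assms(2))

lemma polyfun_line:
  assumes "polyfun f"
  shows "\<exists>p. \<forall>t. f (\<lambda>i. a i + t * b i) = poly p t"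
  using assms
proof induction
  case (const c)
  show ?case by (rule exI[of _ "[:c:]"]) simp
next
  case (coord i)
  show ?case by (rule exI[of _ "[:a i, b i:]"]) simp
next
  case (add f g)
  then show ?case by (metis poly_add)
next
  case (mult f g)
  then show ?case by (metis poly_mult)
qed

text \<open>On the line through \<open>a\<close> and \<open>b\<close> both functions are nonzero
  univariate polynomials, so their product has a non-root.\<close>

lemma polyfun_mult_nonzero:
  assumes "polyfun f" "polyfun g" "f a \<noteq> 0" "g b \<noteq> 0"
  obtains c where "f c \<noteq> 0" "g c \<noteq> 0"
proof -
  define l where "l t = (\<lambda>i. a i + t * (b i - a i))" for t
  obtain p q where p: "\<And>t. f (l t) = poly p t" and q: "\<And>t. g (l t) = poly q t"
    using polyfun_line[OF assms(1), of a "\<lambda>i. b i - a i"]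
      polyfun_line[OF assms(2), of a "\<lambda>i. b i - a i"] unfolding l_def by metis
  have "l 0 = a" "l 1 = b" by (auto simp: l_def)
  then have "poly p 0 \<noteq> 0" "poly q 1 \<noteq> 0" using p[of 0] q[of 1] assms by auto
  then have "p * q \<noteq> 0" by auto
  then obtain t where "poly (p * q) t \<noteq> 0" using poly_all_0_iff_0 by blast
  then show ?thesis using that[of "l t"] p q by auto
qed

text \<open>Functions that become polynomial after multiplication by a power of \<open>w\<close> are
  closed under sums and products. This turns a generic condition on a quotient with denominators
  into a polynomial one.\<close>

lemma polyfun_regular_substitution:
  assumes "polyfun g"
    and R: "\<And>i. \<exists>k G. polyfun G \<and> (\<forall>z. w z \<noteq> 0 \<longrightarrow> R i z * w z ^ k = G z)"
    and "polyfun w"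
  shows "\<exists>k G. polyfun G \<and> (\<forall>z. w z \<noteq> 0 \<longrightarrow> g (\<lambda>i. R i z) * w z ^ k = G z)"
  using assms(1)
proof induction
  case (const c)
  show ?case by (rule exI[of _ 0], rule exI[of _ "\<lambda>_. c"]) (auto intro: polyfun.intros)
next
  case (coord i)
  show ?case using R by blast
next
  case (add f g)
  then obtain k F l G where
    "polyfun F" "\<And>z. w z \<noteq> 0 \<Longrightarrow> f (\<lambda>i. R i z) * w z ^ k = F z"
    "polyfun G" "\<And>z. w z \<noteq> 0 \<Longrightarrow> g (\<lambda>i. R i z) * w z ^ l = G z"
    by blast
  then show ?case using \<open>polyfun w\<close>
    by (intro exI[of _ "k + l"] exI[of _ "\<lambda>z. F z * w z ^ l + G z * w z ^ k"])
       (auto intro!: polyfun_intros simp: power_add ring_distribs simp flip: mult.assoc)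
next
  case (mult f g)
  then obtain k F l G where
    "polyfun F" "\<And>z. w z \<noteq> 0 \<Longrightarrow> f (\<lambda>i. R i z) * w z ^ k = F z"
    "polyfun G" "\<And>z. w z \<noteq> 0 \<Longrightarrow> g (\<lambda>i. R i z) * w z ^ l = G z"
    by blast
  then show ?case
    by (intro exI[of _ "k + l"] exI[of _ "\<lambda>z. F z * G z"])
       (auto intro!: polyfun_intros simp: power_add mult_ac)
qed

section \<open>Elimination of one variable\<close>

text \<open>A polynomial in (x, \<kappa>) arranged by powers of \<kappa>. The degree bound is
  uniform in \<open>x\<close>, so that reversal and division have parameters independent of
  \<open>x\<close>.\<close>

definition polyfam :: "(('i \<Rightarrow> complex) \<Rightarrow> complex poly) \<Rightarrow> bool" where
  "polyfam F \<longleftrightarrow> (\<forall>k. polyfun (\<lambda>x. coeff (F x) k)) \<and> (\<exists>d. \<forall>x. degree (F x) \<le> d)"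

lemma polyfam_monom: "polyfun f \<Longrightarrow> polyfam (\<lambda>x. monom (f x) k)"
  unfolding polyfam_def by (auto intro: polyfun_intros degree_monom_le)

lemma polyfam_add:
  assumes "polyfam F" "polyfam G"
  shows "polyfam (\<lambda>x. F x + G x)"
proof -
  obtain d e where "\<And>x. degree (F x) \<le> d" "\<And>x. degree (G x) \<le> e"
    using assms unfolding polyfam_def by auto
  then have "degree (F x + G x) \<le> max d e" for x
    by (meson degree_add_le_max le_trans max.mono)
  then show ?thesis using assms unfolding polyfam_def by (auto intro: polyfun_intros)
qed

lemma polyfam_mult:
  assumes "polyfam F" "polyfam G"
  shows "polyfam (\<lambda>x. F x * G x)"
proof -
  obtain d e where "\<And>x. degree (F x) \<le> d" "\<And>x. degree (G x) \<le> e"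
    using assms unfolding polyfam_def by auto
  then have "degree (F x * G x) \<le> d + e" for x
    by (meson degree_mult_le le_trans add_mono)
  then show ?thesis using assms unfolding polyfam_def
    by (auto intro!: polyfun_intros simp: coeff_mult)
qed

lemma polyfam_power: "polyfam F \<Longrightarrow> polyfam (\<lambda>x. F x ^ k)"
proof (induction k)
  case 0
  show ?case using polyfam_monom[OF polyfun.const[of 1], of 0] by simp
qed (simp add: polyfam_mult)

lemma polyfam_sum:
  "(\<And>a. a \<in> A \<Longrightarrow> polyfam (F a)) \<Longrightarrow> polyfam (\<lambda>x. \<Sum>a\<in>A. F a x)"
proof (induction A rule: infinite_finite_induct)
  case (insert a A)
  then show ?case by (simp add: polyfam_add)
qed (use polyfam_monom[OF polyfun.const[of 0], of 0] in simp_all)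

lemma polyfun_option_polyfam:
  assumes "polyfun p"
  shows "\<exists>F. polyfam F \<and> (\<forall>x \<kappa>. p (case_option \<kappa> x) = poly (F x) \<kappa>)"
  using assms
proof induction
  case (const c)
  show ?case using polyfam_monom[OF polyfun.const[of c], of 0]
    by (intro exI[of _ "\<lambda>_. monom c 0"]) (auto simp: poly_monom)
next
  case (coord i)
  show ?case
  proof (cases i)
    case None
    then show ?thesis using polyfam_monom[OF polyfun.const[of 1], of 1]
      by (intro exI[of _ "\<lambda>_. monom 1 1"]) (auto simp: poly_monom)
  next
    case (Some j)
    then show ?thesis using polyfam_monom[OF polyfun.coord[of j], of 0]
      by (intro exI[of _ "\<lambda>x. monom (x j) 0"]) (auto simp: poly_monom)
  qed
next
  case (add f g)
  then show ?case by (metis poly_add polyfam_add)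
next
  case (mult f g)
  then show ?case by (metis poly_mult polyfam_mult)
qed

text \<open>Multiplying by the coefficient of degree \<open>D\<close> at each step avoids fractions,
  so the remainder stays polynomial in \<open>x\<close> and \<open>k\<close> does not depend on
  \<open>x\<close>. That coefficient may vanish for some \<open>x\<close>.\<close>

lemma polyfam_pseudo_division:
  assumes P: "polyfam P" "\<And>x i. i > D \<Longrightarrow> coeff (P x) i = 0"
    and f: "polyfam f" "\<And>x i. i \<ge> e \<Longrightarrow> coeff (f x) i = 0"
  shows "\<exists>k q R. polyfam R \<and> (\<forall>x i. i \<ge> D \<longrightarrow> coeff (R x) i = 0) \<and>
           (\<forall>x. smult (coeff (P x) D ^ k) (f x) = q x * P x + R x)"
  using f
proof (induction e arbitrary: f)
  case 0
  then show ?case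
    by (intro exI[of _ 0] exI[of _ "\<lambda>_. 0"] exI[of _ f]) auto
next
  case (Suc e)
  show ?case
  proof (cases "e < D")
    case True
    then show ?thesis using Suc.prems
      by (intro exI[of _ 0] exI[of _ "\<lambda>_. 0"] exI[of _ f]) auto
  next
    case False
    define u where "u x = monom (coeff (f x) e) (e - D)" for x
    \<comment> \<open>The coefficients of degree \<open>e\<close> cancel, so the induction
      hypothesis applies to \<open>f'\<close>.\<close>
    define f' where "f' x = smult (coeff (P x) D) (f x) - u x * P x" for x
    have cP: "polyfun (\<lambda>x. coeff (P x) D)" and cf: "polyfun (\<lambda>x. - coeff (f x) e)"
      using P(1) Suc.prems(1) by (auto simp: polyfam_def intro: polyfun_intros)
    have f'_eq: "f' = (\<lambda>x. monom (coeff (P x) D) 0 * f x + monom (- coeff (f x) e) (e - D) * P x)"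
      by (rule ext) (simp add: f'_def u_def monom_0 flip: minus_monom)
    have pf': "polyfam f'"
      unfolding f'_eq by (intro polyfam_add polyfam_mult polyfam_monom cP cf P Suc.prems)
    have "coeff (f' x) i = 0" if "i \<ge> e" for x i
    proof (cases "i = e")
      case True
      then show ?thesis using False by (simp add: f'_def u_def coeff_monom_mult)
    next
      case ne: False
      then show ?thesis using that False Suc.prems(2)[of i x] P(2)[of "i - (e - D)" x]
        by (auto simp: f'_def u_def coeff_monom_mult)
    qed
    from Suc.IH[OF pf' this] obtain k q R where R: "polyfam R" "\<forall>x i. i \<ge> D \<longrightarrow> coeff (R x) i = 0"
      and eq: "\<And>x. smult (coeff (P x) D ^ k) (f' x) = q x * P x + R x" by blast
    have "smult (coeff (P x) D ^ Suc k) (f x) = (q x + smult (coeff (P x) D ^ k) (u x)) * P x + R x"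
      for x
      using eq[of x] by (simp add: f'_def smult_diff_right algebra_simps)
    then show ?thesis using R
      by (intro exI[of _ "Suc k"] exI[of _ "\<lambda>x. q x + smult (coeff (P x) D ^ k) (u x)"] exI[of _ R])
        auto
  qed
qed

text \<open>Reversal is relative to the fixed \<open>D\<close> instead of the degree, so that it is
  linear in \<open>p\<close> and preserves families.\<close>

definition reversed_poly :: "nat \<Rightarrow> complex poly \<Rightarrow> complex poly" where
  "reversed_poly D p = (\<Sum>j\<le>D. monom (coeff p j) (D - j))"

lemma polyfam_reversed: "polyfam F \<Longrightarrow> polyfam (\<lambda>x. reversed_poly D (F x))"
  unfolding reversed_poly_def by (intro polyfam_sum polyfam_monom) (auto simp: polyfam_def)

lemma coeff_reversed_poly: "coeff (reversed_poly D p) i = (if i \<le> D then coeff p (D - i) else 0)"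
proof -
  have "coeff (reversed_poly D p) i = (\<Sum>j\<le>D. if D - j = i then coeff p j else 0)"
    unfolding reversed_poly_def by (simp add: coeff_sum)
  also have "\<dots> = (\<Sum>j\<le>D. if j = D - i then (if i \<le> D then coeff p j else 0) else 0)"
    by (intro sum.cong) auto
  also have "\<dots> = (if i \<le> D then coeff p (D - i) else 0)" by simp
  finally show ?thesis .
qed

lemma poly_reversed_poly:
  assumes "degree p \<le> D" "x \<noteq> 0"
  shows "poly (reversed_poly D p) x = x ^ D * poly p (1 / x)"
proof -
  have "poly (reversed_poly D p) x = (\<Sum>j\<le>D. coeff p j * x ^ (D - j))"
    unfolding reversed_poly_def by (simp add: poly_sum poly_monom)
  also have "\<dots> = (\<Sum>j\<le>D. x ^ D * (coeff p j * (1 / x) ^ j))"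
    using assms(2) by (intro sum.cong) (auto simp: power_diff power_one_over)
  also have "\<dots> = x ^ D * poly p (1 / x)"
  proof -
    have "poly p (1 / x) = (\<Sum>j\<le>D. coeff p j * (1 / x) ^ j)"
      unfolding poly_altdef using assms(1)
      by (intro sum.mono_neutral_left) (auto simp: coeff_eq_0)
    then show ?thesis by (simp add: sum_distrib_left)
  qed
  finally show ?thesis .
qed

text \<open>
  The polynomials are reversed so that the nonvanishing of \<open>p\<close> at \<open>\<kappa> = 0\<close> controls the leading
  coefficient. If all roots of \<open>p\<close> were roots of \<open>h\<close>, then \<open>p\<close> would divide a power of \<open>h\<close>, so the
  pseudo-remainder would vanish; at \<open>x1\<close> it does not.
\<close>

lemma polyfun_elimination:
  assumes "polyfun p" "polyfun h"
    and "p (case_option \<kappa>1 x1) = 0" "p (case_option 0 x1) \<noteq> 0" "h (case_option \<kappa>1 x1) \<noteq> 0"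
  shows "\<exists>g. polyfun g \<and> g x1 \<noteq> 0 \<and>
    (\<forall>x. g x \<noteq> 0 \<longrightarrow> (\<exists>\<kappa>. p (case_option \<kappa> x) = 0 \<and> h (case_option \<kappa> x) \<noteq> 0))"
proof -
  obtain F where F: "polyfam F" "\<And>x \<kappa>. p (case_option \<kappa> x) = poly (F x) \<kappa>"
    using polyfun_option_polyfam[OF assms(1)] by blast
  obtain H where H: "polyfam H" "\<And>x \<kappa>. h (case_option \<kappa> x) = poly (H x) \<kappa>"
    using polyfun_option_polyfam[OF assms(2)] by blast
  obtain D where D: "\<And>x. degree (F x) \<le> D" using F by (auto simp: polyfam_def)
  obtain E where E: "\<And>x. degree (H x) \<le> E" using H by (auto simp: polyfam_def)
  define P where "P x = reversed_poly D (F x)" for x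
  \<comment> \<open>The extra factor makes \<open>J x\<close> vanish at 0, so a root of
    \<open>P x\<close> that is not a root of \<open>J x\<close> can be inverted to a value of
    \<kappa>.\<close>
  define J where "J x = monom 1 1 * reversed_poly E (H x)" for x
  have Pf: "polyfam P" and Jf: "polyfam J"
    unfolding P_def J_def by (intro polyfam_reversed polyfam_mult polyfam_monom polyfun.const F H)+
  have J0: "poly (J x) 0 = 0" for x by (simp add: J_def poly_monom)
  \<comment> \<open>Roots of a polynomial of degree \<open>D\<close> have multiplicity at most
    \<open>D\<close>, hence the \<open>D\<close>-th power.\<close>
  obtain e where e: "\<And>x. degree (J x ^ D) < e"
    using polyfam_power[OF Jf, of D] unfolding polyfam_def by (meson le_imp_less_Suc)
  have "\<And>x i. i > D \<Longrightarrow> coeff (P x) i = 0" by (simp add: P_def coeff_reversed_poly)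
  moreover have "\<And>x i. i \<ge> e \<Longrightarrow> coeff (J x ^ D) i = 0"
    using e by (meson coeff_eq_0 order_less_le_trans)
  ultimately obtain k q R where R: "polyfam R" "\<And>x i. i \<ge> D \<Longrightarrow> coeff (R x) i = 0"
    and div: "\<And>x. smult (coeff (P x) D ^ k) (J x ^ D) = q x * P x + R x"
    using polyfam_pseudo_division[OF Pf _ polyfam_power[OF Jf, of D]] by metis
  have lead: "coeff (P x) D = p (case_option 0 x)" for x
    by (simp add: P_def coeff_reversed_poly F(2) poly_0_coeff_0)
  have "\<kappa>1 \<noteq> 0" using assms by auto
  then have "poly (P x1) (1 / \<kappa>1) = 0" "poly (J x1) (1 / \<kappa>1) \<noteq> 0"
    using assms by (auto simp: P_def J_def poly_reversed_poly D E F(2) H(2) poly_monom)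
  then have "poly (R x1) (1 / \<kappa>1) \<noteq> 0"
    using arg_cong[OF div[of x1], of "\<lambda>p. poly p (1 / \<kappa>1)"] assms lead by auto
  then obtain j where j: "coeff (R x1) j \<noteq> 0" by (metis poly_0 leading_coeff_0_iff)
  \<comment> \<open>The first factor forces \<open>P x\<close> to have degree exactly
    \<open>D\<close>, the second a nonzero remainder.\<close>
  define g where "g x = coeff (P x) D * coeff (R x) j" for x
  have "polyfun g" unfolding g_def using Pf R(1) by (auto simp: polyfam_def intro: polyfun.mult)
  moreover have "g x1 \<noteq> 0" using j assms lead by (simp add: g_def)
  moreover have "\<exists>\<kappa>. p (case_option \<kappa> x) = 0 \<and> h (case_option \<kappa> x) \<noteq> 0" if "g x \<noteq> 0" for x
  proof -
    have cD: "coeff (P x) D \<noteq> 0" and Rj: "coeff (R x) j \<noteq> 0" using that by (auto simp: g_def)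
    have degP: "degree (P x) = D"
      using cD by (intro antisym le_degree degree_le) (auto simp: P_def coeff_reversed_poly)
    have "\<not> (\<forall>\<mu>. poly (P x) \<mu> = 0 \<longrightarrow> poly (J x) \<mu> = 0)"
    proof
      assume "\<forall>\<mu>. poly (P x) \<mu> = 0 \<longrightarrow> poly (J x) \<mu> = 0"
      then have "P x dvd J x ^ D" using nullstellensatz_univariate[of "P x" "J x"] degP cD by auto
      then have "P x dvd q x * P x + R x" using div[of x] by (metis dvd_smult)
      then have "P x dvd R x" by (simp add: dvd_add_right_iff)
      moreover have "R x \<noteq> 0" using Rj by auto
      ultimately have "degree (P x) \<le> degree (R x)" by (rule dvd_imp_degree_le)
      then show False using R(2)[of "degree (R x)" x] degP \<open>R x \<noteq> 0\<close> by auto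
    qed
    then obtain \<mu> where mu: "poly (P x) \<mu> = 0" "poly (J x) \<mu> \<noteq> 0" by blast
    then have "\<mu> \<noteq> 0" using J0 by metis
    with mu show ?thesis
      by (intro exI[of _ "1 / \<mu>"])
        (auto simp: P_def J_def poly_reversed_poly D E F(2) H(2) poly_monom)
  qed
  ultimately show ?thesis by blast
qed

section \<open>A kernel vector made of cofactors\<close>

lemma det_nonzero_iff_trivial_kernel:
  fixes M :: "complex^'n::finite^'n"
  shows "det M \<noteq> 0 \<longleftrightarrow> (\<forall>v. M *v v = 0 \<longrightarrow> v = 0)"
  using matrix_left_invertible_ker[of M] invertible_left_inverse[of M] invertible_det_nz[of M] by blast

definition replace_row :: "'n \<Rightarrow> complex^'n \<Rightarrow> complex^'n^'n \<Rightarrow> complex^'n::finite^'n" where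
  "replace_row b w M = (\<chi> i. if i = b then w else M $ i)"

text \<open>The cofactors of row \<open>b\<close>. Unlike an arbitrary kernel vector, they are
  polynomial in the entries of \<open>M\<close>.\<close>

definition cofactor_row :: "'n \<Rightarrow> complex^'n^'n \<Rightarrow> complex^'n::finite" where
  "cofactor_row b M = (\<chi> l. det (replace_row b (axis l 1) M))"

lemma replace_row_mult:
  "(replace_row b w M *v v) $ i = (if i = b then (\<Sum>l\<in>UNIV. w $ l * v $ l) else (M *v v) $ i)"
  by (simp add: replace_row_def matrix_vector_mult_def)

lemma laplace_expansion: "(\<Sum>l\<in>UNIV. w $ l * cofactor_row b M $ l) = det (replace_row b w M)"
proof -
  have "det (replace_row b w M) =
      det (\<chi> i. if i = b then (\<Sum>l\<in>UNIV. w $ l *s axis l 1) else M $ i)"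
    unfolding basis_expansion replace_row_def ..
  also have "\<dots> = (\<Sum>l\<in>UNIV. det (\<chi> i. if i = b then w $ l *s axis l 1 else M $ i))"
    by (rule det_linear_row_sum) simp
  also have "\<dots> = (\<Sum>l\<in>UNIV. w $ l * cofactor_row b M $ l)"
    unfolding det_row_mul by (simp add: cofactor_row_def replace_row_def)
  finally show ?thesis by simp
qed

text \<open>Pairing the cofactors with row \<open>a\<close> of \<open>M\<close> gives
  \<open>det M\<close> if \<open>a = b\<close>, and otherwise a determinant with two equal
  rows.\<close>

lemma cofactor_row_in_kernel:
  assumes "det M = 0"
  shows "M *v cofactor_row b M = 0"
proof -
  have "det (replace_row b (M $ a) M) = 0" for a
  proof (cases "a = b")
    case True
    then have "replace_row b (M $ a) M = M" by (simp add: replace_row_def vec_eq_iff)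
    then show ?thesis using assms by simp
  next
    case False
    then have "row a (replace_row b (M $ a) M) = row b (replace_row b (M $ a) M)"
      by (simp add: replace_row_def row_def)
    then show ?thesis using det_identical_rows[OF False] by blast
  qed
  then show ?thesis by (simp add: vec_eq_iff matrix_vector_mult_def laplace_expansion)
qed

text \<open>The vector \<open>w\<close> below is orthogonal to \<open>y\<close>, so placing it in
  row \<open>b\<close> keeps \<open>y\<close> in the kernel; the claim is the expansion of this zero
  determinant along row \<open>b\<close>.\<close>

lemma cofactor_row_proportional:
  assumes "M *v y = 0" "y \<noteq> 0"
  shows "y $ k * cofactor_row b M $ l = y $ l * cofactor_row b M $ k"
proof (cases "k = l")
  case False
  define w where "w = (\<chi> i. if i = l then y $ k else if i = k then - y $ l else 0)"
  have expand: "(\<Sum>i\<in>UNIV. w $ i * u $ i) = y $ k * u $ l - y $ l * u $ k" for u :: "complex^'a"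
  proof -
    have "(\<Sum>i\<in>UNIV. w $ i * u $ i)
        = (\<Sum>i\<in>UNIV. (if i = l then y $ k * u $ l else 0) + (if i = k then - y $ l * u $ k else 0))"
      using False by (intro sum.cong) (auto simp: w_def)
    then show ?thesis by (simp add: sum.distrib)
  qed
  have "(replace_row b w M *v y) $ i = 0" for i
    unfolding replace_row_mult using expand[of y] assms(1) by (simp add: mult.commute)
  then have "replace_row b w M *v y = 0" by (simp add: vec_eq_iff)
  then have "det (replace_row b w M) = 0" using assms(2) det_nonzero_iff_trivial_kernel by blast
  then show ?thesis using laplace_expansion[of w b M] expand by simp
qed auto

section \<open>Polynomials in a cyclic shift\<close>

text \<open>The operator \<open>\<Sum>j\<le>m. x\<^sub>j S\<^sup>j\<close>, where \<open>S\<close>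
  sends \<open>v\<close> to \<open>v \<circ> s\<close> and \<open>x\<^sub>j\<close> acts
  diagonally.\<close>

definition shift_matrix :: "('n \<Rightarrow> 'n) \<Rightarrow> nat \<Rightarrow> (nat \<times> 'n \<Rightarrow> complex) \<Rightarrow> complex^'n::finite^'n" where
  "shift_matrix s m x = (\<chi> a b. \<Sum>j\<le>m. if (s ^^ j) a = b then x (j, a) else 0)"

text \<open>The operator \<open>S - r\<close>. The two terms are kept separate so that they combine
  correctly when \<open>s a = a\<close>, as happens on a single vertex.\<close>

definition linear_factor :: "('n \<Rightarrow> 'n) \<Rightarrow> ('n \<Rightarrow> complex) \<Rightarrow> complex^'n::finite^'n" where
  "linear_factor s r = (\<chi> a b. (if b = s a then 1 else 0) - (if b = a then r a else 0))"

lemma shift_matrix_mult: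
  "(shift_matrix s m x *v v) $ a = (\<Sum>j\<le>m. x (j, a) * v $ (s ^^ j) a)"
proof -
  have "(shift_matrix s m x *v v) $ a
      = (\<Sum>b\<in>UNIV. \<Sum>j\<le>m. if b = (s ^^ j) a then x (j, a) * v $ b else 0)"
    unfolding shift_matrix_def matrix_vector_mult_def
    by (auto simp: sum_distrib_right intro!: sum.cong)
  also have "\<dots> = (\<Sum>j\<le>m. \<Sum>b\<in>UNIV. if b = (s ^^ j) a then x (j, a) * v $ b else 0)"
    by (rule sum.swap)
  finally show ?thesis by simp
qed

lemma linear_factor_mult: "(linear_factor s r *v v) $ a = v $ s a - r a * v $ a"
proof -
  have "(linear_factor s r *v v) $ a =
      (\<Sum>b\<in>UNIV. (if b = s a then v $ b else 0) - (if b = a then r a * v $ b else 0))"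
    unfolding linear_factor_def matrix_vector_mult_def by (auto intro!: sum.cong simp: left_diff_distrib)
  then show ?thesis by (simp add: sum_subtractf)
qed

text \<open>The hypothesis compares coefficients of \<open>S\<^sup>j\<close>: moving the diagonal
  \<open>r\<close> to the left past \<open>S\<^sup>j\<close> turns it into
  \<open>r \<circ> s\<^sup>j\<close>.\<close>

lemma shift_matrix_mult_linear_factor:
  assumes "\<And>j a. j \<le> Suc m \<Longrightarrow> x (j, a) =
     (if j = 0 then 0 else q (j - 1, a)) - (if j \<le> m then q (j, a) * r ((s ^^ j) a) else 0)"
  shows "shift_matrix s (Suc m) x = shift_matrix s m q ** linear_factor s r"
proof -
  have "(shift_matrix s (Suc m) x *v v) $ a = ((shift_matrix s m q ** linear_factor s r) *v v) $ a"
    for v a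
  proof -
    have "(shift_matrix s (Suc m) x *v v) $ a
        = (\<Sum>j\<le>Suc m. (if j = 0 then 0 else q (j - 1, a)) * v $ (s ^^ j) a)
          - (\<Sum>j\<le>Suc m. (if j \<le> m then q (j, a) * r ((s ^^ j) a) else 0) * v $ (s ^^ j) a)"
      unfolding shift_matrix_mult
      by (auto simp: assms left_diff_distrib simp flip: sum_subtractf intro!: sum.cong)
    also have "\<dots> = (\<Sum>j\<le>m. q (j, a) * v $ (s ^^ Suc j) a)
          - (\<Sum>j\<le>m. q (j, a) * r ((s ^^ j) a) * v $ (s ^^ j) a)"
      by (subst sum.atMost_Suc_shift) simp
    also have "\<dots> = (\<Sum>j\<le>m. q (j, a) * (linear_factor s r *v v) $ (s ^^ j) a)"
      by (simp add: linear_factor_mult algebra_simps flip: sum_subtractf)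
    finally show ?thesis
      by (simp add: shift_matrix_mult flip: matrix_vector_mul_assoc)
  qed
  then show ?thesis by (simp add: matrix_eq vec_eq_iff)
qed

text \<open>
  If \<open>P = \<Sum>j. x\<^sub>j S\<^sup>j\<close> annihilates the quasiperiodic sequence \<open>n \<mapsto> \<kappa>\<^sup>n v\<^sub>n\<close>, then
  \<open>S - r\<close> with \<open>r\<^sub>n = \<kappa> v\<^sub>n\<^sub>+\<^sub>1 / v\<^sub>n\<close> is a right factor of \<open>P\<close>; this is the
  resulting quotient.
\<close>

definition quotient_numerator ::
  "('n \<Rightarrow> 'n) \<Rightarrow> nat \<Rightarrow> (nat \<times> 'n \<Rightarrow> complex) \<Rightarrow> complex \<Rightarrow> complex^'n::finite \<Rightarrow> nat \<Rightarrow> 'n \<Rightarrow> complex"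
where
  "quotient_numerator s m x \<kappa> v j a = (\<Sum>i\<in>{j<..m}. x (i, a) * \<kappa> ^ (i - Suc j) * v $ (s ^^ i) a)"

definition quotient ::
  "('n \<Rightarrow> 'n) \<Rightarrow> nat \<Rightarrow> (nat \<times> 'n \<Rightarrow> complex) \<Rightarrow> complex \<Rightarrow> complex^'n::finite \<Rightarrow> nat \<times> 'n \<Rightarrow> complex"
where
  "quotient s m x \<kappa> v = (\<lambda>(j, a). quotient_numerator s m x \<kappa> v j a / v $ (s ^^ Suc j) a)"

lemma quotient_numerator_rec:
  assumes "j < m"
  shows "quotient_numerator s m x \<kappa> v j a =
    x (Suc j, a) * v $ (s ^^ Suc j) a + \<kappa> * quotient_numerator s m x \<kappa> v (Suc j) a"
proof -
  have "{j<..m} = insert (Suc j) {Suc j<..m}" using assms by auto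
  then have "quotient_numerator s m x \<kappa> v j a = x (Suc j, a) * v $ (s ^^ Suc j) a
      + (\<Sum>i\<in>{Suc j<..m}. x (i, a) * \<kappa> ^ (i - Suc j) * v $ (s ^^ i) a)"
    unfolding quotient_numerator_def by simp
  also have "(\<Sum>i\<in>{Suc j<..m}. x (i, a) * \<kappa> ^ (i - Suc j) * v $ (s ^^ i) a)
      = \<kappa> * quotient_numerator s m x \<kappa> v (Suc j) a"
    unfolding quotient_numerator_def sum_distrib_left
  proof (intro sum.cong refl)
    fix i assume "i \<in> {Suc j<..m}"
    then have "i - Suc j = Suc (i - Suc (Suc j))" by auto
    then show "x (i, a) * \<kappa> ^ (i - Suc j) * v $ (s ^^ i) a =
        \<kappa> * (x (i, a) * \<kappa> ^ (i - Suc (Suc j)) * v $ (s ^^ i) a)" by simp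
  qed
  finally show ?thesis .
qed

text \<open>The factor \<open>v $ (s ^^ Suc j) a\<close> cancels in \<open>r\<close> below. The
  recursion then gives the coefficients with \<open>j > 0\<close>, the kernel equation gives
  \<open>j = 0\<close>, and at the top the numerator is an empty sum.\<close>

lemma shift_matrix_right_division:
  assumes ker: "shift_matrix s (Suc m) (\<lambda>(j, a). x (j, a) * \<kappa> ^ j) *v v = 0"
    and nz: "\<And>a. v $ a \<noteq> 0"
  shows "shift_matrix s (Suc m) x =
    shift_matrix s m (quotient s (Suc m) x \<kappa> v) ** linear_factor s (\<lambda>a. \<kappa> * v $ s a / v $ a)"
proof (rule shift_matrix_mult_linear_factor)
  fix j a assume j: "j \<le> Suc m"
  let ?S = "\<lambda>j. quotient_numerator s (Suc m) x \<kappa> v j a"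
  have r: "quotient s (Suc m) x \<kappa> v (j, a) * (\<kappa> * v $ s ((s ^^ j) a) / v $ (s ^^ j) a)
      = \<kappa> * ?S j / v $ (s ^^ j) a" for j
    using nz by (simp add: quotient_def)
  have top: "?S (Suc m) = 0" by (simp add: quotient_numerator_def)
  have q: "quotient s (Suc m) x \<kappa> v (j - 1, a) = x (j, a) + \<kappa> * ?S j / v $ (s ^^ j) a" if "j > 0"
  proof -
    obtain i where i: "j = Suc i" using gr0_implies_Suc[OF \<open>j > 0\<close>] by blast
    have "?S i = x (j, a) * v $ (s ^^ j) a + \<kappa> * ?S j"
      using quotient_numerator_rec[of i "Suc m"] i j by simp
    then show ?thesis using nz i by (simp add: quotient_def field_simps)
  qed
  have x0: "x (0, a) = - (\<kappa> * ?S 0 / v $ a)"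
  proof -
    have "0 = (\<Sum>j\<le>Suc m. x (j, a) * \<kappa> ^ j * v $ (s ^^ j) a)"
      using arg_cong[OF ker, of "\<lambda>u. u $ a"] by (simp add: shift_matrix_mult)
    also have "{..Suc m} = insert 0 {0<..Suc m}" by auto
    also have "(\<Sum>j\<in>insert 0 {0<..Suc m}. x (j, a) * \<kappa> ^ j * v $ (s ^^ j) a)
        = x (0, a) * v $ a + (\<Sum>j\<in>{0<..Suc m}. x (j, a) * \<kappa> ^ j * v $ (s ^^ j) a)"
      by simp
    also have "(\<Sum>j\<in>{0<..Suc m}. x (j, a) * \<kappa> ^ j * v $ (s ^^ j) a) = \<kappa> * ?S 0"
      unfolding quotient_numerator_def sum_distrib_left
    proof (intro sum.cong refl)
      fix i assume "i \<in> {0<..Suc m}"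
      then have "i = Suc (i - Suc 0)" by auto
      then have "\<kappa> ^ i = \<kappa> * \<kappa> ^ (i - Suc 0)" by (metis power_Suc)
      then show "x (i, a) * \<kappa> ^ i * v $ (s ^^ i) a
          = \<kappa> * (x (i, a) * \<kappa> ^ (i - Suc 0) * v $ (s ^^ i) a)" by simp
    qed
    finally show ?thesis using nz[of a] by (simp add: field_simps eq_neg_iff_add_eq_0)
  qed
  show "x (j, a) = (if j = 0 then 0 else quotient s (Suc m) x \<kappa> v (j - 1, a)) -
      (if j \<le> m then quotient s (Suc m) x \<kappa> v (j, a) * (\<kappa> * v $ s ((s ^^ j) a) / v $ (s ^^ j) a)
       else 0)"
    unfolding r using q x0 top j by (cases "j = Suc m") auto
qed

section \<open>Generic factorization into bidiagonal matrices\<close>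

definition bidiagonal :: "('n \<Rightarrow> 'n) \<Rightarrow> (complex^'n::finite^'n) set" where
  "bidiagonal s = {A. \<forall>a b. b \<noteq> a \<longrightarrow> b \<noteq> s a \<longrightarrow> A $ a $ b = 0}"

definition factorable :: "('n \<Rightarrow> 'n) \<Rightarrow> nat \<Rightarrow> complex^'n::finite^'n \<Rightarrow> bool" where
  "factorable s k T \<longleftrightarrow> (\<exists>A. (\<forall>i\<in>{1..k}. A i \<in> bidiagonal s) \<and> T = descending_prod A k)"

text \<open>Division produces right factors, whereas the definition recurses on the left.\<close>

lemma descending_prod_Suc_right:
  "descending_prod A (Suc k) = descending_prod (\<lambda>i. A (Suc i)) k ** A (Suc 0)"
proof (induction k)
  case (Suc k)
  have "descending_prod A (Suc (Suc k)) = A (Suc (Suc k)) ** descending_prod A (Suc k)" by simp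
  then show ?case unfolding Suc by (simp add: matrix_mul_assoc)
qed simp

lemma linear_factor_bidiagonal: "linear_factor s r \<in> bidiagonal s"
  by (simp add: bidiagonal_def linear_factor_def)

lemma factorable_mult:
  assumes "factorable s k T" "B \<in> bidiagonal s"
  shows "factorable s (Suc k) (T ** B)"
proof -
  obtain A where A: "\<forall>i\<in>{1..k}. A i \<in> bidiagonal s" "T = descending_prod A k"
    using assms by (auto simp: factorable_def)
  define A' where "A' i = (if i = 1 then B else A (i - 1))" for i
  have "descending_prod A' (Suc k) = descending_prod (\<lambda>i. A' (Suc i)) k ** B"
    using descending_prod_Suc_right[of A' k] by (simp add: A'_def)
  moreover have "descending_prod (\<lambda>i. A' (Suc i)) k = descending_prod A k"
  proof -
    have "descending_prod (\<lambda>i. A' (Suc i)) j = descending_prod A j" for j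
      by (induction j) (simp_all add: A'_def)
    then show ?thesis .
  qed
  moreover have "A' i \<in> bidiagonal s" if "i \<in> {1..Suc k}" for i
  proof (cases "i = 1")
    case False
    then have "i - 1 \<in> {1..k}" using that by auto
    then show ?thesis using A(1) False by (simp add: A'_def)
  qed (use assms(2) in \<open>simp add: A'_def\<close>)
  ultimately show ?thesis using A(2) unfolding factorable_def by metis
qed

lemma shift_matrix_0_factorable: "factorable s (Suc 0) (shift_matrix s 0 x)"
  unfolding factorable_def
  by (rule exI[of _ "\<lambda>_. shift_matrix s 0 x"]) (auto simp: bidiagonal_def shift_matrix_def)

text \<open>The product \<open>Q(S) (S - 1)\<close> by coefficients; \<open>q\<close> is extended by
  zero so that the top coefficient follows the same formula.\<close>

lemma shift_matrix_difference:
  assumes "\<And>a. q (Suc m, a) = 0"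
  shows "shift_matrix s (Suc m) (\<lambda>(j, a). (if j = 0 then 0 else q (j - 1, a)) - q (j, a)) =
    shift_matrix s m q ** linear_factor s (\<lambda>_. 1)"
proof (rule shift_matrix_mult_linear_factor)
  fix j a assume "j \<le> Suc m"
  then show "(case (j, a) of (j, a) \<Rightarrow> (if j = 0 then 0 else q (j - 1, a)) - q (j, a)) =
      (if j = 0 then 0 else q (j - 1, a)) - (if j \<le> m then q (j, a) * 1 else 0)"
    using assms by (cases "j = Suc m") auto
qed

lemma polyfun_shift_matrix_entry:
  assumes "\<And>i. polyfun (\<lambda>z. x z i)"
  shows "polyfun (\<lambda>z. shift_matrix s m (x z) $ a $ b)"
  unfolding shift_matrix_def vec_lambda_beta by (intro polyfun_sum polyfun_if polyfun.const assms)

lemma polyfun_cofactor_row: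
  assumes "\<And>a b. polyfun (\<lambda>z. M z $ a $ b)"
  shows "polyfun (\<lambda>z. cofactor_row b (M z) $ l)"
  unfolding cofactor_row_def replace_row_def vec_lambda_beta
proof (rule polyfun_det)
  show "polyfun (\<lambda>z. (\<chi> i. if i = b then axis l 1 else M z $ i) $ a $ c)" for a c
    using assms[of a c] by (cases "a = b") (auto intro: polyfun.const)
qed

text \<open>The bundled variable \<open>z\<close> consists of the coefficients \<open>z (Some (j, a))\<close> and of \<open>\<kappa> = z None\<close>.\<close>

definition twisted_matrix ::
  "('n \<Rightarrow> 'n) \<Rightarrow> nat \<Rightarrow> ((nat \<times> 'n) option \<Rightarrow> complex) \<Rightarrow> complex^'n::finite^'n"
where
  "twisted_matrix s m z = shift_matrix s m (\<lambda>(j, a). z (Some (j, a)) * z None ^ j)"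

lemma polyfun_twisted_matrix_entry: "polyfun (\<lambda>z. twisted_matrix s m z $ a $ b)"
  unfolding twisted_matrix_def
proof (rule polyfun_shift_matrix_entry)
  show "polyfun (\<lambda>z. case i of (j, a) \<Rightarrow> z (Some (j, a)) * z None ^ j)" for i :: "nat \<times> 'a"
    by (cases i) (simp, intro polyfun.mult polyfun_power polyfun.coord)
qed

text \<open>Bijectivity from every start \<open>a\<close> makes the \<open>x (j, a)\<close> with
  \<open>j < CARD('n)\<close> coordinates for the entries of row \<open>a\<close>.\<close>

locale cyclic_shift =
  fixes s :: "'n::finite \<Rightarrow> 'n"
  assumes cycle: "\<And>a. bij_betw (\<lambda>j. (s ^^ j) a) {..<CARD('n)} UNIV"
begin

text \<open>Cutting the cycle after \<open>a0\<close> leaves a path from \<open>s a0\<close> to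
  \<open>a0\<close> through all points, along which \<open>f\<close> is constant.\<close>

lemma shift_invariant_constant:
  assumes "\<And>a. a \<noteq> a0 \<Longrightarrow> f (s a) = f a"
  shows "f a = f (s a0)"
proof -
  have *: "f ((s ^^ j) (s a0)) = f (s a0)" if "\<forall>i<j. (s ^^ i) (s a0) \<noteq> a0" for j
    using that
  proof (induction j)
    case (Suc j)
    then show ?case using assms[of "(s ^^ j) (s a0)"] by simp
  qed simp
  have reach: "\<exists>j. (s ^^ j) (s a0) = b" for b
  proof -
    have "b \<in> (\<lambda>j. (s ^^ j) (s a0)) ` {..<CARD('n)}" using cycle by (simp add: bij_betw_def)
    then show ?thesis by (elim imageE) blast
  qed
  \<comment> \<open>The first arrival at \<open>a0\<close>. Reducing exponents modulo
    \<open>Suc k\<close> gives walks that do not meet \<open>a0\<close> before their end.\<close>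
  define k where "k = (LEAST j. (s ^^ j) (s a0) = a0)"
  have k: "(s ^^ k) (s a0) = a0" "\<forall>i<k. (s ^^ i) (s a0) \<noteq> a0"
    unfolding k_def using LeastI_ex[OF reach] not_less_Least by blast+
  obtain l where l: "(s ^^ l) (s a0) = a" using reach by blast
  have period: "(s ^^ Suc k) (s a0) = s a0" using k(1) by simp
  have "(s ^^ (l mod Suc k)) (s a0) = a" using funpow_mod_eq[OF period, of l] l by simp
  moreover have "\<forall>i<l mod Suc k. (s ^^ i) (s a0) \<noteq> a0"
  proof (intro allI impI)
    fix i assume "i < l mod Suc k"
    moreover have "l mod Suc k < Suc k" by simp
    ultimately have "i < k" by linarith
    then show "(s ^^ i) (s a0) \<noteq> a0" using k(2) by blast
  qed
  ultimately show ?thesis using *[of "l mod Suc k"] by metis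
qed

text \<open>The rows of \<open>S - 1\<close> other than \<open>b\<close> force a kernel vector to be
  constant along the cycle, and the unit row in place of row \<open>b\<close> forces it to
  vanish.\<close>

lemma cofactor_row_shift_minus_one:
  "cofactor_row b (linear_factor s (\<lambda>_. 1)) $ b \<noteq> 0"
proof -
  have "v = 0" if "replace_row b (axis b 1) (linear_factor s (\<lambda>_. 1)) *v v = 0" for v
  proof -
    have eq: "(if i = b then (\<Sum>l\<in>UNIV. axis b 1 $ l * v $ l)
        else (linear_factor s (\<lambda>_. 1) *v v) $ i) = 0" for i
      using arg_cong[OF that, of "\<lambda>u. u $ i"] by (simp add: replace_row_mult)
    have "v $ s i = v $ i" if "i \<noteq> b" for i using eq[of i] that by (simp add: linear_factor_mult)
    then have "v $ i = v $ s b" for i by (rule shift_invariant_constant)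
    moreover have "v $ b = 0" using eq[of b] by (simp add: axis_def if_distrib if_distribR cong: if_cong)
    ultimately show ?thesis by (metis vec_eq_iff zero_index)
  qed
  then show ?thesis
    unfolding cofactor_row_def vec_lambda_beta by (subst det_nonzero_iff_trivial_kernel) blast
qed

text \<open>Each denominator is a single coordinate of \<open>v z\<close>, hence a factor of the
  product, and the exponent 1 suffices.\<close>

lemma quotient_regular:
  fixes v :: "((nat \<times> 'n) option \<Rightarrow> complex) \<Rightarrow> complex^'n"
  assumes v: "\<And>l. polyfun (\<lambda>z. v z $ l)"
  shows "\<exists>k G. polyfun G \<and> (\<forall>z. (\<Prod>l\<in>UNIV. v z $ l) \<noteq> 0 \<longrightarrow>
    quotient s m (z \<circ> Some) (z None) (v z) i * (\<Prod>l\<in>UNIV. v z $ l) ^ k = G z)"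
proof -
  obtain j a where i: "i = (j, a)" by (cases i)
  let ?l = "(s ^^ Suc j) a"
  let ?N = "\<lambda>z. quotient_numerator s m (z \<circ> Some) (z None) (v z) j a"
  have "polyfun ?N"
    unfolding quotient_numerator_def o_def by (intro polyfun_sum polyfun.mult polyfun_power polyfun.coord v)
  then have "polyfun (\<lambda>z. ?N z * (\<Prod>l\<in>UNIV - {?l}. v z $ l))"
    by (intro polyfun.mult polyfun_prod v)
  moreover have "quotient s m (z \<circ> Some) (z None) (v z) i * (\<Prod>l\<in>UNIV. v z $ l) ^ 1
      = ?N z * (\<Prod>l\<in>UNIV - {?l}. v z $ l)" if "(\<Prod>l\<in>UNIV. v z $ l) \<noteq> 0" for z
  proof -
    have "(\<Prod>l\<in>UNIV. v z $ l) = v z $ ?l * (\<Prod>l\<in>UNIV - {?l}. v z $ l)"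
      by (rule prod.remove) auto
    moreover have "v z $ ?l \<noteq> 0" using that by (simp add: prod_zero_iff)
    ultimately show ?thesis by (simp add: i quotient_def)
  qed
  ultimately show ?thesis by blast
qed

text \<open>
  A degree-\<open>m + 1\<close> polynomial splits off a linear right factor at a root \<open>\<kappa>\<close> of the determinant of its
  twisted matrix. The nondegeneracy of this construction need only be checked at the single polynomial
  \<open>Q (S - 1)\<close> with \<open>\<kappa> = 1\<close> and kernel vector \<open>(1, \<dots>, 1)\<close>, \<open>Q\<close> generic.
\<close>

lemma generic_shift_matrix_factorable:
  "\<exists>g x. polyfun g \<and> g x \<noteq> 0 \<and> (\<forall>j a. j > m \<longrightarrow> x (j, a) = 0) \<and>
     (\<forall>x. g x \<noteq> 0 \<longrightarrow> factorable s (Suc m) (shift_matrix s m x))"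
proof (induction m)
  case 0
  show ?case
    using shift_matrix_0_factorable polyfun.const[of 1]
    by (intro exI[of _ "\<lambda>_. 1"] exI[of _ "\<lambda>_. 0"]) auto
next
  case (Suc m)
  then obtain g Q1 where g: "polyfun g" "g Q1 \<noteq> 0" and Q1: "\<And>j a. j > m \<Longrightarrow> Q1 (j, a) = 0"
    and fac: "\<And>x. g x \<noteq> 0 \<Longrightarrow> factorable s (Suc m) (shift_matrix s m x)" by blast
  obtain b :: 'n where True by simp
  let ?M = "twisted_matrix s (Suc m)"
  define v where "v z = cofactor_row b (?M z)" for z
  define w where "w z = (\<Prod>l\<in>UNIV. v z $ l)" for z
  define q where "q z = quotient s (Suc m) (z \<circ> Some) (z None) (v z)" for z
  have v_poly: "polyfun (\<lambda>z. v z $ l)" for l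
    unfolding v_def by (intro polyfun_cofactor_row polyfun_twisted_matrix_entry)
  have w_poly: "polyfun w" unfolding w_def by (intro polyfun_prod v_poly)
  \<comment> \<open>Where \<open>w\<close> is nonzero, \<open>G z \<noteq> 0\<close> says that the
    quotient lies in the generic set of the induction hypothesis.\<close>
  obtain k G where G: "polyfun G" "\<And>z. w z \<noteq> 0 \<Longrightarrow> g (q z) * w z ^ k = G z"
    using polyfun_regular_substitution[OF g(1), of w "\<lambda>i z. q z i"] quotient_regular[OF v_poly] w_poly
    unfolding w_def q_def by blast

  \<comment> \<open>\<open>P Q\<close> lists the coefficients of \<open>Q(S) (S - 1)\<close> for the
    truncation of \<open>Q\<close> to degree \<open>m\<close>.\<close>
  define trunc where "trunc Q = (\<lambda>(j, a). if j \<le> m then Q (j, a) else 0)"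
    for Q :: "nat \<times> 'n \<Rightarrow> complex"
  define P where "P Q = (\<lambda>(j, a). (if j = 0 then 0 else trunc Q (j - 1, a)) - trunc Q (j, a))"
    for Q :: "nat \<times> 'n \<Rightarrow> complex"
  have trunc_poly: "polyfun (\<lambda>Q. trunc Q i)" for i
    by (cases i) (auto simp: trunc_def intro: polyfun_intros)
  have P_poly: "polyfun (\<lambda>Q. P Q i)" for i
    unfolding P_def using trunc_poly by (cases i) (auto intro!: polyfun_intros)
  have caseP_poly: "polyfun (\<lambda>Q. case_option c (P Q) i)" for c i
    using P_poly by (cases i) (auto intro: polyfun_intros)
  have M1: "?M (case_option 1 (P Q)) = shift_matrix s m (trunc Q) ** linear_factor s (\<lambda>_. 1)" for Q
    using shift_matrix_difference[of "trunc Q" m s]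
    by (simp add: twisted_matrix_def P_def trunc_def)
  have ker: "?M (case_option 1 (P Q)) *v 1 = 0" for Q
    unfolding M1 by (simp add: vec_eq_iff linear_factor_mult shift_matrix_mult flip: matrix_vector_mul_assoc)
  have det1: "det (?M (case_option 1 (P Q))) = 0" for Q
    using ker[of Q] det_nonzero_iff_trivial_kernel by force
  \<comment> \<open>The kernel contains the all-ones vector, so all the cofactors agree and one of
    them decides whether \<open>w\<close> vanishes.\<close>
  have v1: "v (case_option 1 (P Q)) $ l = v (case_option 1 (P Q)) $ b" for Q l
    using cofactor_row_proportional[OF ker[of Q], of b b l] by (simp add: v_def)

  \<comment> \<open>The constant polynomial 1, for which \<open>P Q2\<close> is
    \<open>S - 1\<close>. It witnesses the conditions on \<open>w\<close> and at \<kappa> = 0, while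
    \<open>Q1\<close> witnesses the one on \<open>g\<close>; a common \<open>Q\<close> exists
    because both are polynomial in \<open>Q\<close>.\<close>
  define Q2 :: "nat \<times> 'n \<Rightarrow> complex" where "Q2 = (\<lambda>(j, a). if j = 0 then 1 else 0)"
  have "trunc Q1 = Q1" using Q1 by (auto simp: trunc_def fun_eq_iff)
  then have nz1: "g (trunc Q1) \<noteq> 0" using g by simp
  have "w (case_option 1 (P Q2)) \<noteq> 0"
  proof -
    have "(shift_matrix s m (trunc Q2) *v u) $ a = u $ a" for u a
    proof -
      have "(shift_matrix s m (trunc Q2) *v u) $ a = (\<Sum>j\<le>m. if j = 0 then u $ a else 0)"
        unfolding shift_matrix_mult by (intro sum.cong) (auto simp: trunc_def Q2_def)
      then show ?thesis by simp
    qed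
    then have "shift_matrix s m (trunc Q2) = mat 1" by (simp add: matrix_eq vec_eq_iff)
    then have "v (case_option 1 (P Q2)) $ b \<noteq> 0"
      unfolding v_def M1 using cofactor_row_shift_minus_one by simp
    then show ?thesis unfolding w_def prod_zero_iff[OF finite] using v1 by metis
  qed
  moreover have "det (?M (case_option 0 (P Q2))) \<noteq> 0"
  proof -
    have "(?M (case_option 0 (P Q2)) *v u) $ a = - u $ a" for u a
    proof -
      have "(?M (case_option 0 (P Q2)) *v u) $ a = (\<Sum>j\<le>Suc m. if j = 0 then - u $ a else 0)"
        unfolding twisted_matrix_def shift_matrix_mult
        by (intro sum.cong) (auto simp: P_def trunc_def Q2_def)
      then show ?thesis by simp
    qed
    then show ?thesis by (simp add: det_nonzero_iff_trivial_kernel vec_eq_iff)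
  qed
  moreover have "polyfun (\<lambda>Q. w (case_option 1 (P Q)) * det (?M (case_option 0 (P Q))))"
  proof (rule polyfun.mult)
    show "polyfun (\<lambda>Q. w (case_option 1 (P Q)))"
      using polyfun_compose[OF w_poly caseP_poly] .
    show "polyfun (\<lambda>Q. det (?M (case_option 0 (P Q))))"
      using polyfun_compose[OF polyfun_det[OF polyfun_twisted_matrix_entry] caseP_poly] .
  qed
  moreover have "polyfun (\<lambda>Q. g (trunc Q))" using polyfun_compose[OF g(1) trunc_poly] .
  ultimately obtain Q where Q: "g (trunc Q) \<noteq> 0"
      "w (case_option 1 (P Q)) * det (?M (case_option 0 (P Q))) \<noteq> 0"
    using nz1 polyfun_mult_nonzero[of "\<lambda>Q. g (trunc Q)"
        "\<lambda>Q. w (case_option 1 (P Q)) * det (?M (case_option 0 (P Q)))" Q1 Q2] by auto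

  \<comment> \<open>Dividing \<open>Q(S) (S - 1)\<close> by \<open>S - 1\<close> returns
    \<open>Q\<close>: at \<kappa> = 1 with a constant kernel vector the numerators
    telescope.\<close>
  have "q (case_option 1 (P Q)) = trunc Q"
  proof
    fix i :: "nat \<times> 'n"
    obtain j a where i: "i = (j, a)" by (cases i)
    have vb: "v (case_option 1 (P Q)) $ b \<noteq> 0" using Q(2) by (auto simp: w_def prod_zero_iff)
    have "(\<Sum>i\<in>{j<..Suc m}. P Q (i, a)) = trunc Q (j, a)"
    proof (cases "j \<le> m")
      case True
      have "{j<..Suc m} = Suc ` {j..m}" using True by (auto simp: image_Suc_atLeastAtMost)
      then have "(\<Sum>i\<in>{j<..Suc m}. P Q (i, a)) = (\<Sum>i\<in>{j..m}. trunc Q (i, a) - trunc Q (Suc i, a))"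
        by (subst \<open>{j<..Suc m} = Suc ` {j..m}\<close>, subst sum.reindex) (simp_all add: P_def)
      also have "\<dots> = trunc Q (j, a) - trunc Q (Suc m, a)"
        using sum_Suc_diff[of j m "\<lambda>i. - trunc Q (i, a)"] True by simp
      finally show ?thesis by (simp add: trunc_def)
    qed (simp add: trunc_def)
    moreover have "quotient_numerator s (Suc m) (P Q) 1 (v (case_option 1 (P Q))) j a
        = (\<Sum>i\<in>{j<..Suc m}. P Q (i, a)) * v (case_option 1 (P Q)) $ b"
      unfolding quotient_numerator_def v1[of Q "(s ^^ _) a"] by (simp add: sum_distrib_right)
    ultimately show "q (case_option 1 (P Q)) i = trunc Q i"
      using vb by (simp add: q_def quotient_def i o_def v1[of Q "s ((s ^^ j) a)"])
  qed
  then have "w (case_option 1 (P Q)) * G (case_option 1 (P Q)) \<noteq> 0"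
    using G(2)[of "case_option 1 (P Q)"] Q by auto
  moreover have "polyfun (\<lambda>z. w z * G z)" using w_poly G(1) by (rule polyfun.mult)
  moreover have "polyfun (\<lambda>z. det (?M z))" by (rule polyfun_det[OF polyfun_twisted_matrix_entry])
  moreover have "det (?M (case_option 0 (P Q))) \<noteq> 0" using Q by auto
  \<comment> \<open>Elimination based at \<kappa> = 1 and \<open>P Q\<close>: generic
    \<open>x\<close> have a root \<kappa> whose kernel vector has no zero coordinate and whose
    quotient is again generic.\<close>
  ultimately obtain g' where g': "polyfun g'" "g' (P Q) \<noteq> 0" and root: "\<And>x. g' x \<noteq> 0 \<Longrightarrow>
      \<exists>\<kappa>. det (?M (case_option \<kappa> x)) = 0 \<and> w (case_option \<kappa> x) * G (case_option \<kappa> x) \<noteq> 0"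
    using polyfun_elimination[of "\<lambda>z. det (?M z)" "\<lambda>z. w z * G z" 1 "P Q"] det1[of Q] by auto
  have "factorable s (Suc (Suc m)) (shift_matrix s (Suc m) x)" if gx: "g' x \<noteq> 0" for x
  proof -
    obtain \<kappa> where "det (?M (case_option \<kappa> x)) = 0"
      and wG: "w (case_option \<kappa> x) * G (case_option \<kappa> x) \<noteq> 0"
      using root[OF gx] by blast
    then have "?M (case_option \<kappa> x) *v v (case_option \<kappa> x) = 0"
      unfolding v_def by (intro cofactor_row_in_kernel)
    moreover have "v (case_option \<kappa> x) $ a \<noteq> 0" for a using wG by (auto simp: w_def prod_zero_iff)
    ultimately obtain r where
      "shift_matrix s (Suc m) x = shift_matrix s m (q (case_option \<kappa> x)) ** linear_factor s r"
      using shift_matrix_right_division[of s m x \<kappa> "v (case_option \<kappa> x)"]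
      by (auto simp: twisted_matrix_def q_def o_def)
    moreover have "g (q (case_option \<kappa> x)) \<noteq> 0" using wG G(2)[of "case_option \<kappa> x"] by auto
    ultimately show ?thesis using factorable_mult fac linear_factor_bidiagonal by metis
  qed
  moreover have "P Q (j, a) = 0" if "j > Suc m" for j a using that by (simp add: P_def trunc_def)
  ultimately show ?case using g' by blast
qed

end

section \<open>Passage to almost all matrices\<close>

lemma polyfun_continuous_on:
  assumes "polyfun g" "\<And>i. continuous_on S (\<lambda>T. \<phi> T i)"
  shows "continuous_on S (\<lambda>T. g (\<phi> T))"
  using assms(1) by induction (auto intro!: continuous_intros assms(2))

text \<open>The zero set is closed. If it had an interior point, the restriction to the line from
  there to \<open>T1\<close> would have infinitely many roots, yet it is nonzero at
  \<open>T1\<close>.\<close>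

lemma almost_all_polyfun:
  fixes R :: "complex^'n::finite^'m::finite \<Rightarrow> bool"
  assumes g: "polyfun g" "g (\<lambda>(a, b). T1 $ a $ b) \<noteq> 0"
    and R: "\<And>T. g (\<lambda>(a, b). T $ a $ b) \<noteq> 0 \<Longrightarrow> R T"
  shows "almost_all R"
proof -
  define f where "f T = g (\<lambda>(a, b). T $ a $ b)" for T :: "complex^'n^'m"
  have "continuous_on UNIV f"
    unfolding f_def by (rule polyfun_continuous_on[OF g(1)]) (auto intro!: continuous_intros simp: split_beta)
  then have closed: "closed {T. f T = 0}"
    by (simp add: closed_Collect_eq continuous_on_const)
  have "T0 \<notin> interior {T. f T = 0}" for T0
  proof
    assume T0: "T0 \<in> interior {T. f T = 0}"
    define l where "l t = (\<chi> a b. T0 $ a $ b + t * (T1 $ a $ b - T0 $ a $ b))" for t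
    obtain p where p: "\<And>t. f (l t) = poly p t"
      using polyfun_line[OF g(1), of "\<lambda>(a, b). T0 $ a $ b" "\<lambda>(a, b). T1 $ a $ b - T0 $ a $ b"]
      unfolding f_def l_def by (auto simp: case_prod_unfold)
    have "continuous_on UNIV l" unfolding l_def by (intro continuous_intros)
    then have "open (l -` interior {T. f T = 0})" by (simp add: open_vimage)
    moreover have l01: "l 0 = T0" "l 1 = T1" by (simp_all add: l_def vec_eq_iff)
    moreover have "0 \<in> l -` interior {T. f T = 0}" using T0 l01 by simp
    ultimately have "infinite (l -` interior {T. f T = 0})" using finite_imp_not_open by blast
    moreover have "l -` interior {T. f T = 0} \<subseteq> {t. poly p t = 0}"
      using interior_subset p by fastforce
    ultimately have "p = 0" using poly_roots_finite finite_subset by blast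
    then show False using p[of 1] l01 g(2) by (simp add: f_def)
  qed
  then have "interior {T. f T = 0} = {}" by blast
  moreover have "closure (closure {T. \<not> R T}) \<subseteq> {T. f T = 0}"
    unfolding closure_closure by (intro closure_minimal closed) (use R in \<open>auto simp: f_def\<close>)
  ultimately show ?thesis
    unfolding almost_all_def nowhere_dense_def using interior_mono by blast
qed

text \<open>With degree bound \<open>CARD('n) - 1\<close> every matrix is a polynomial in the shift,
  its coefficients being its entries relabelled by \<open>\<phi>\<close>.\<close>

lemma (in cyclic_shift) almost_all_factorable:
  "almost_all (factorable s CARD('n))"
proof -
  let ?m = "CARD('n) - 1"
  have N: "Suc ?m = CARD('n)" by simp
  obtain g x1 where g: "polyfun g" "g x1 \<noteq> 0" and x1: "\<And>j a. j > ?m \<Longrightarrow> x1 (j, a) = 0"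
    and fac: "\<And>x. g x \<noteq> 0 \<Longrightarrow> factorable s (Suc ?m) (shift_matrix s ?m x)"
    using generic_shift_matrix_factorable[of ?m] by blast
  define \<phi> where "\<phi> y = (\<lambda>(j, a). if j \<le> ?m then y (a, (s ^^ j) a) else 0)"
    for y :: "'n \<times> 'n \<Rightarrow> complex"
  have phi: "polyfun (\<lambda>y. \<phi> y i)" for i
    by (cases i) (auto simp: \<phi>_def intro: polyfun_intros)
  have cyc: "bij_betw (\<lambda>j. (s ^^ j) a) {..?m} UNIV" for a
    using cycle[of a] N by (metis lessThan_Suc_atMost)
  have shift: "shift_matrix s ?m (\<phi> (\<lambda>(a, b). T $ a $ b)) = T" for T
  proof -
    have "(\<Sum>j\<le>?m. if (s ^^ j) a = b then \<phi> (\<lambda>(a, b). T $ a $ b) (j, a) else 0) = T $ a $ b" for a b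
    proof -
      have "(\<Sum>j\<le>?m. if (s ^^ j) a = b then \<phi> (\<lambda>(a, b). T $ a $ b) (j, a) else 0)
          = (\<Sum>j\<le>?m. (\<lambda>c. if c = b then T $ a $ c else 0) ((s ^^ j) a))"
        by (intro sum.cong) (auto simp: \<phi>_def)
      also have "\<dots> = (\<Sum>c\<in>UNIV. if c = b then T $ a $ c else 0)"
        by (rule sum.reindex_bij_betw[OF cyc])
      finally show ?thesis by simp
    qed
    then show ?thesis by (simp add: shift_matrix_def vec_eq_iff)
  qed
  \<comment> \<open>The matrix with coefficients \<open>x1\<close>; since \<open>x1\<close> vanishes
    above degree \<open>?m\<close>, nothing is lost.\<close>
  define T1 :: "complex^'n^'n" where
    "T1 = (\<chi> a b. x1 (inv_into {..?m} (\<lambda>j. (s ^^ j) a) b, a))"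
  have "\<phi> (\<lambda>(a, b). T1 $ a $ b) = x1"
  proof
    fix i :: "nat \<times> 'n"
    obtain j a where i: "i = (j, a)" by (cases i)
    show "\<phi> (\<lambda>(a, b). T1 $ a $ b) i = x1 i"
      using x1[of j a] inv_into_f_f[OF bij_betw_imp_inj_on[OF cyc[of a]], of j]
      by (cases "j \<le> ?m") (auto simp: i \<phi>_def T1_def)
  qed
  then have nz: "g (\<phi> (\<lambda>(a, b). T1 $ a $ b)) \<noteq> 0" using g(2) by simp
  show ?thesis
  proof (rule almost_all_polyfun[OF polyfun_compose[OF g(1) phi] nz])
    fix T assume "g (\<phi> (\<lambda>(a, b). T $ a $ b)) \<noteq> 0"
    from fac[OF this] show "factorable s CARD('n) T" unfolding shift N .
  qed
qed

section \<open>The successor map of a Hamiltonian cycle\<close>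

lemma pcas_nth:
  assumes "pcas u p v" "i < length p"
  shows "snd (p ! i) = (if Suc i = length p then v else fst (p ! Suc i))"
  using assms
proof (induction p arbitrary: u i)
  case (Cons e es)
  show ?case
  proof (cases i)
    case 0
    then show ?thesis using Cons.prems by (cases es) auto
  next
    case (Suc k)
    then show ?thesis using Cons.IH[of "snd e" k] Cons.prems by auto
  qed
qed simp

text \<open>Every vertex is the tail of exactly one arc of \<open>p\<close>, so these arcs form the
  graph of a map \<open>s\<close>, which acts on positions in \<open>p\<close> as addition of 1
  modulo the length.\<close>

lemma hamiltonian_cycle_successor:
  fixes Abar :: "complex^'n::finite^'n"
  assumes "pre_digraph.hamiltonian_cycle (with_proj (matrix_digraph Abar)) p"
  obtains s where "cyclic_shift s" "\<And>a. Abar $ a $ s a = 1"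
proof -
  interpret pre_digraph "with_proj (matrix_digraph Abar)" .
  have verts: "pverts (matrix_digraph Abar) = UNIV"
    and arcs_eq: "parcs (matrix_digraph Abar) = {(n, l). Abar $ n $ l = 1}"
    by (simp_all add: matrix_digraph_def)
  obtain u where u: "awalk u p u" and ne: "p \<noteq> []"
    and once: "\<And>v. count_list (map fst p) v = 1"
  proof -
    have h: "cycle p" "\<forall>v. count_list (map fst p) v = 1"
      using assms unfolding hamiltonian_cycle_def with_proj_simps verts by simp_all
    then show ?thesis using that unfolding cycle_def by metis
  qed
  have cas: "pcas u p u" and arcs: "\<And>e. e \<in> set p \<Longrightarrow> Abar $ fst e $ snd e = 1"
    using u unfolding awalk_def cas_with_proj_eq with_proj_simps arcs_eq by auto
  have set: "set (map fst p) = UNIV"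
    using once by (metis UNIV_eq_I count_list_0_iff zero_neq_one)
  have len: "length p = CARD('n)"
    using sum_count_set[of "map fst p" UNIV] by (simp add: once)
  have "distinct (map fst p)" by (rule card_distinct) (simp only: set len length_map)
  define f where "f i = fst (p ! i)" for i
  have inj: "f i = f j \<Longrightarrow> i < length p \<Longrightarrow> j < length p \<Longrightarrow> i = j" for i j
    using nth_eq_iff_index_eq[OF \<open>distinct (map fst p)\<close>, of i j] by (simp add: f_def)
  have surj: "\<exists>i<length p. f i = a" for a
    using set by (metis UNIV_I f_def in_set_conv_nth length_map nth_map)
  have f0: "f 0 = u" using cas ne by (cases p) (auto simp: f_def)
  define s where "s a = snd (p ! (SOME i. i < length p \<and> f i = a))" for a
  have sf: "s (f i) = snd (p ! i)" if "i < length p" for i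
  proof -
    have "(SOME j. j < length p \<and> f j = f i) = i" using that inj by (intro some_equality) auto
    then show ?thesis by (simp add: s_def)
  qed
  have step: "s (f i) = f (Suc i mod length p)" if "i < length p" for i
    using sf[OF that] pcas_nth[OF cas that] f0 that by (auto simp: f_def)
  have iter: "(s ^^ j) (f i) = f ((i + j) mod length p)" if "i < length p" for i j
  proof (induction j)
    case (Suc j)
    then show ?case using step[of "(i + j) mod length p"] ne by (simp add: mod_Suc_eq)
  qed (use that in simp)
  have "bij_betw (\<lambda>j. (s ^^ j) a) {..<CARD('n)} UNIV" for a
  proof -
    obtain i where i: "i < length p" "f i = a" using surj by blast
    have "inj_on (\<lambda>j. (s ^^ j) a) {..<CARD('n)}"
    proof (rule inj_onI)
      fix j k assume "j \<in> {..<CARD('n)}" "k \<in> {..<CARD('n)}" "(s ^^ j) a = (s ^^ k) a"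
      then have jk: "j < length p" "k < length p" and "f ((i + j) mod length p) = f ((i + k) mod length p)"
        using iter[OF i(1)] i(2) len by auto
      then have "(i + j) mod length p = (i + k) mod length p" using inj ne by simp
      then have "[i + j = i + k] (mod length p)" by (simp add: cong_def)
      then have "[j = k] (mod length p)" by (simp add: cong_add_lcancel_nat)
      then show "j = k" using jk by (simp add: cong_def)
    qed
    moreover from this have "(\<lambda>j. (s ^^ j) a) ` {..<CARD('n)} = UNIV"
      by (intro card_subset_eq) (simp_all add: card_image)
    ultimately show ?thesis by (simp add: bij_betw_def)
  qed
  moreover have "Abar $ a $ s a = 1" for a
    using surj[of a] sf arcs by (metis f_def nth_mem)
  ultimately show ?thesis using that[of s] unfolding cyclic_shift_def by blast
qed


theorem mainTheorem1:
  fixes Abar :: "complex^'n::finite^'n"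
  assumes "\<forall>n l. Abar $ n $ l \<in> {0, 1}"
    and "\<forall>n. Abar $ n $ n = 1"
    and "\<exists>p. pre_digraph.hamiltonian_cycle (with_proj (matrix_digraph Abar)) p"
  shows "almost_all (\<lambda>T :: complex^'n^'n.
           \<exists>A :: nat \<Rightarrow> complex^'n^'n.
             (\<forall>k \<in> {1..CARD('n)}. A k \<in> spr Abar) \<and> T = descending_prod A CARD('n))"
proof -
  obtain s where s: "cyclic_shift s" and arc: "\<And>a. Abar $ a $ s a = 1"
    using assms(3) hamiltonian_cycle_successor by metis
  \<comment> \<open>The diagonal and the arcs of the cycle are positions where \<open>Abar\<close>
    is 1, so bidiagonal factors are admissible and the exceptional set can only shrink.\<close>
  have "bidiagonal s \<subseteq> spr Abar"
  proof
    fix A assume A: "A \<in> bidiagonal s"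
    have "A $ n $ l = 0" if "Abar $ n $ l = 0" for n l
    proof -
      have "l \<noteq> n" "l \<noteq> s n" using that assms(2) arc[of n] by auto
      then show ?thesis using A by (simp add: bidiagonal_def)
    qed
    then show "A \<in> spr Abar" by (simp add: spr_def)
  qed
  then have "closure {T. \<not> (\<exists>A. (\<forall>k \<in> {1..CARD('n)}. A k \<in> spr Abar) \<and> T = descending_prod A CARD('n))}
      \<subseteq> closure {T. \<not> factorable s CARD('n) T}" (is "closure ?B \<subseteq> closure ?F")
    unfolding factorable_def by (intro closure_mono) blast
  then have "interior (closure ?B) \<subseteq> interior (closure ?F)" by (rule interior_mono)
  moreover have "interior (closure ?F) = {}"
    using cyclic_shift.almost_all_factorable[OF s]
    by (simp add: almost_all_def nowhere_dense_def)
  ultimately show ?thesis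
    unfolding almost_all_def nowhere_dense_def closure_closure by simp
qed

end
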